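(* For all $2\times 2$ real positive definite matrices $B$ and $P$, the equation $$XBX^2B^3X^2BX=P$$ has a unique real solution $X$, i.e. there is exactly one real $2\times 2$ positive semidefinite matrix $X$ satisfying it.
   Context: Real positive definite (semidefinite) matrices are real symmetric matrices with all eigenvalues positive (nonnegative). A solution of such a word equation is by convention required to be positive semidefinite. *)

theory Defs
  imports "HOL-Analysis.Analysis"
begin

definition eigenvalue :: "real^'n^'n \<Rightarrow> real \<Rightarrow> bool" where
  "eigenvalue A c \<longleftrightarrow> (\<exists>v. v \<noteq> 0 \<and> A *v v = c *s v)"

text \<open>Only real eigenvalues are considered below; for a real symmetric matrix these are
  all of its eigenvalues.\<close>

definition pos_def :: "real^'n^'n \<Rightarrow> bool" where
  "pos_def A \<longleftrightarrow> transpose A = A \<and> (\<forall>c. eigenvalue A c \<longrightarrow> 0 < c)"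

definition pos_semidef :: "real^'n^'n \<Rightarrow> bool" where
  "pos_semidef A \<longleftrightarrow> transpose A = A \<and> (\<forall>c. eigenvalue A c \<longrightarrow> 0 \<le> c)"

text \<open>Powers with respect to the matrix product. The overloaded power \<open>A ^ k\<close>
  is not usable here, since multiplication on the vector type is componentwise.\<close>

primrec mat_power :: "real^'n^'n \<Rightarrow> nat \<Rightarrow> real^'n^'n" where
  "mat_power A 0 = mat 1"
| "mat_power A (Suc k) = A ** mat_power A k"

end

theory Submission
  imports Defs
begin

text \<open>
  Rotating coordinates, let \<open>B\<close> be diagonal with entries \<open>a, b\<close>, and let \<open>X\<close> have diagonal
  entries \<open>x, z\<close>, off-diagonal entry \<open>y\<close> and determinant \<open>d\<close>. Determinants in the equation give
  \<open>(a b)^5 d^6 = det P\<close>, so \<open>d\<close> is known, \<open>y^2 = x z - d\<close>, and since the off-diagonal entry of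
  the word is a positive multiple of \<open>y\<close>, it remains to find the pair \<open>(x, z)\<close> with \<open>x z \<ge> d\<close>
  from the two diagonal entries. Each of these is a polynomial in \<open>x, z, y^2\<close> with nonnegative
  coefficients, so a level set of the first one is the graph of a function \<open>\<zeta>\<close> of \<open>x\<close>. The
  Jacobian of the two entries with respect to \<open>(x, z)\<close> factors into two polynomials in
  \<open>x, z, x z - d, d\<close> with nonnegative coefficients, hence is positive. So the second entry is
  strictly decreasing along the level set, and it takes every admissible value by the
  intermediate value theorem.
\<close>

section \<open>Slope of a continuous level curve\<close>

text \<open>As \<open>\<zeta>\<close> is known to be continuous, differentiability of
  \<open>F\<close> at a single point is enough: increments \<open>h\<close>, \<open>D\<close> along
  the curve satisfy p h + q D = o(|h| + |D|). Since q is nonzero, D = O(h), which improves the error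
  to o(h).\<close>

lemma implicit_curve_derivative:
  fixes F :: "real \<times> real \<Rightarrow> real"
  assumes F: "(F has_derivative (\<lambda>(h, k). p * h + q * k)) (at (x, \<zeta> x))"
    and "q \<noteq> 0" and \<zeta>: "isCont \<zeta> x"
    and level: "\<forall>\<^sub>F t in nhds x. F (t, \<zeta> t) = F (x, \<zeta> x)"
  shows "(\<zeta> has_real_derivative - p / q) (at x)"
  unfolding has_field_derivative_def has_derivative_at_alt
proof (intro conjI allI impI)
  show "bounded_linear ((*) (- p / q))"
    by (rule bounded_linear_mult_right)
  fix e :: real
  assume "0 < e"
  define m where "m = \<bar>p / q\<bar>"
  \<comment> \<open>The cap 1/2 lets the term \<open>k * R\<close> below be absorbed into the left
    side; the other bound makes the resulting factor \<open>2 * k * (1 + m)\<close> at most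
    \<open>e\<close>.\<close>
  define k where "k = min (1 / 2) (e / (2 * (1 + m)))"
  have "0 \<le> m" by (simp add: m_def)
  have k: "0 < k" "k \<le> 1 / 2" "2 * k * (1 + m) \<le> e"
  proof -
    show "0 < k" "k \<le> 1 / 2"
      using \<open>0 < e\<close> \<open>0 \<le> m\<close> by (simp_all only: k_def min.cobounded1) simp
    have "k \<le> e / (2 * (1 + m))" by (simp add: k_def)
    then show "2 * k * (1 + m) \<le> e" using \<open>0 \<le> m\<close> by (simp add: pos_le_divide_eq mult_ac)
  qed
  obtain \<delta> where "0 < \<delta>" and \<delta>: "\<And>y. norm (y - (x, \<zeta> x)) < \<delta> \<Longrightarrow>
      \<bar>F y - F (x, \<zeta> x) - (case y - (x, \<zeta> x) of (h, k) \<Rightarrow> p * h + q * k)\<bar>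
        \<le> k * \<bar>q\<bar> * norm (y - (x, \<zeta> x))"
    using F k(1) \<open>q \<noteq> 0\<close> unfolding has_derivative_at_alt
    by (metis mult_pos_pos real_norm_def zero_less_abs_iff)
  have "isCont (\<lambda>t. (t, \<zeta> t)) x"
    using \<zeta> by (intro continuous_intros)
  then have "((\<lambda>t. (t, \<zeta> t)) \<longlongrightarrow> (x, \<zeta> x)) (nhds x)"
    using isCont_def tendsto_at_iff_tendsto_nhds by blast
  then have "\<forall>\<^sub>F t in nhds x. dist (t, \<zeta> t) (x, \<zeta> x) < \<delta>"
    using \<open>0 < \<delta>\<close> by (rule tendstoD)
  with level have "\<forall>\<^sub>F t in nhds x. norm (\<zeta> t - \<zeta> x - - p / q * (t - x)) \<le> e * norm (t - x)"
  proof eventually_elim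
    case (elim t)
    define h D where "h = t - x" and "D = \<zeta> t - \<zeta> x"
    have "\<bar>p * h + q * D\<bar> \<le> k * \<bar>q\<bar> * norm (h, D)"
      using \<delta>[of "(t, \<zeta> t)"] elim by (simp add: dist_norm h_def D_def abs_minus_commute)
    also have "\<dots> \<le> k * \<bar>q\<bar> * (\<bar>h\<bar> + \<bar>D\<bar>)"
      using k(1) norm_Pair_le[of h D] by (intro mult_left_mono) auto
    finally have *: "\<bar>q\<bar> * \<bar>D + p / q * h\<bar> \<le> \<bar>q\<bar> * (k * (\<bar>h\<bar> + \<bar>D\<bar>))"
      using \<open>q \<noteq> 0\<close> by (simp add: abs_mult[symmetric] algebra_simps)
    define R where "R = \<bar>D + p / q * h\<bar>"
    have R: "R \<le> k * (\<bar>h\<bar> + \<bar>D\<bar>)"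
      using * \<open>q \<noteq> 0\<close> by (simp add: R_def)
    have "\<bar>D\<bar> \<le> R + m * \<bar>h\<bar>"
      using abs_triangle_ineq4[of "D + p / q * h" "p / q * h"] by (simp add: R_def m_def abs_mult)
    then have "k * (\<bar>h\<bar> + \<bar>D\<bar>) \<le> k * (\<bar>h\<bar> + (R + m * \<bar>h\<bar>))"
      using k(1) by (intro mult_left_mono) auto
    also have "\<dots> = k * (1 + m) * \<bar>h\<bar> + k * R"
      by (simp add: algebra_simps)
    also have "\<dots> \<le> k * (1 + m) * \<bar>h\<bar> + 1 / 2 * R"
      using k(2) by (intro add_left_mono mult_right_mono) (auto simp: R_def)
    finally have "R \<le> 2 * k * (1 + m) * \<bar>h\<bar>"
      using R by (simp add: mult.assoc)
    also have "\<dots> \<le> e * \<bar>h\<bar>"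
      using k(3) by (intro mult_right_mono) auto
    finally show ?case by (simp add: R_def h_def D_def)
  qed
  then show "\<exists>d>0. \<forall>y. norm (y - x) < d \<longrightarrow>
      norm (\<zeta> y - \<zeta> x - - p / q * (y - x)) \<le> e * norm (y - x)"
    unfolding eventually_nhds_metric by (simp add: dist_norm)
qed

section \<open>Entries of the word as polynomials, and their Jacobian\<close>

text \<open>
  With \<open>u = y^2\<close>, the matrix \<open>N = X B X^2\<close> has diagonal entries \<open>ndiag a b x z u\<close> and
  \<open>ndiag b a z x u\<close>; its off-diagonal entries are \<open>y\<close> times \<open>noff a b x z u\<close> and
  \<open>noff b a z x u\<close>. The word equals \<open>N B^3\<close> times the transpose of \<open>N\<close>; its entries are given
  by \<open>pdiag\<close> and \<open>y\<close> times \<open>poff\<close> in the same way.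
\<close>

definition ndiag :: "real \<Rightarrow> real \<Rightarrow> real \<Rightarrow> real \<Rightarrow> real \<Rightarrow> real" where
  "ndiag a b x z u = a * x * (x^2 + u) + b * u * (x + z)"

definition noff :: "real \<Rightarrow> real \<Rightarrow> real \<Rightarrow> real \<Rightarrow> real \<Rightarrow> real" where
  "noff a b x z u = a * x * (x + z) + b * (u + z^2)"

definition pdiag :: "real \<Rightarrow> real \<Rightarrow> real \<Rightarrow> real \<Rightarrow> real \<Rightarrow> real" where
  "pdiag a b x z u = a^3 * (ndiag a b x z u)^2 + b^3 * u * (noff a b x z u)^2"

definition poff :: "real \<Rightarrow> real \<Rightarrow> real \<Rightarrow> real \<Rightarrow> real \<Rightarrow> real" where
  "poff a b x z u = a^3 * ndiag a b x z u * noff b a z x u + b^3 * noff a b x z u * ndiag b a z x u"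

text \<open>
  The partial derivatives are those of \<open>pdiag a b x z (x * z - d)\<close>, with \<open>d\<close> fixed, written in
  terms of \<open>u = x * z - d\<close>.
\<close>

definition pdiag_dx :: "real \<Rightarrow> real \<Rightarrow> real \<Rightarrow> real \<Rightarrow> real \<Rightarrow> real" where
  "pdiag_dx a b x z u =
    2 * a^3 * ndiag a b x z u * (a * (x^2 + u) + a * x * (2 * x + z) + b * z * (x + z) + b * u)
    + b^3 * (z * (noff a b x z u)^2 + 2 * u * noff a b x z u * (a * (2 * x + z) + b * z))"

definition pdiag_dz :: "real \<Rightarrow> real \<Rightarrow> real \<Rightarrow> real \<Rightarrow> real \<Rightarrow> real" where
  "pdiag_dz a b x z u =
    2 * a^3 * ndiag a b x z u * (a * x^2 + b * x * (x + z) + b * u)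
    + b^3 * (x * (noff a b x z u)^2 + 2 * u * noff a b x z u * (a * x + b * (x + 2 * z)))"

text \<open>For \<open>u = y^2\<close> this is multiplicativity of the determinant: N has
  determinant a b (x z - u)^3, and the word is N B^3 times the transpose of N. Being a polynomial
  identity, it can also be used at \<open>u = x * z - d\<close> before any \<open>y\<close> is
  chosen.\<close>

lemma pdiag_poff_det:
  "pdiag a b x z u * pdiag b a z x u - u * (poff a b x z u)^2 = (a * b)^5 * (x * z - u)^6"
proof -
  have "ndiag a b x z u * ndiag b a z x u - u * noff a b x z u * noff b a z x u = a * b * (x * z - u)^3"
    unfolding ndiag_def noff_def by algebra
  moreover have "pdiag a b x z u * pdiag b a z x u - u * (poff a b x z u)^2 =
    (a * b)^3 * (ndiag a b x z u * ndiag b a z x u - u * noff a b x z u * noff b a z x u)^2"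
    unfolding pdiag_def poff_def by algebra
  ultimately show ?thesis by algebra
qed

lemma noff_nonneg: "0 < a \<Longrightarrow> 0 < b \<Longrightarrow> 0 \<le> x \<Longrightarrow> 0 \<le> z \<Longrightarrow> 0 \<le> u \<Longrightarrow> 0 \<le> noff a b x z u"
  by (simp add: noff_def)

lemma ndiag_pos: "0 < a \<Longrightarrow> 0 < b \<Longrightarrow> 0 < x \<Longrightarrow> 0 < z \<Longrightarrow> 0 \<le> u \<Longrightarrow> 0 < ndiag a b x z u"
  unfolding ndiag_def by (intro add_pos_nonneg mult_pos_pos mult_nonneg_nonneg) auto

lemma noff_pos: "0 < a \<Longrightarrow> 0 < b \<Longrightarrow> 0 < x \<Longrightarrow> 0 < z \<Longrightarrow> 0 \<le> u \<Longrightarrow> 0 < noff a b x z u"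
  unfolding noff_def by (intro add_pos_nonneg mult_pos_pos mult_nonneg_nonneg) auto

lemma poff_pos: "0 < a \<Longrightarrow> 0 < b \<Longrightarrow> 0 < x \<Longrightarrow> 0 < z \<Longrightarrow> 0 \<le> u \<Longrightarrow> 0 < poff a b x z u"
  unfolding poff_def by (intro add_pos_pos mult_pos_pos ndiag_pos noff_pos zero_less_power)

lemma pdiag_dz_pos: "0 < a \<Longrightarrow> 0 < b \<Longrightarrow> 0 < x \<Longrightarrow> 0 < z \<Longrightarrow> 0 \<le> u \<Longrightarrow> 0 < pdiag_dz a b x z u"
  unfolding pdiag_dz_def
  by (intro add_pos_nonneg mult_pos_pos mult_nonneg_nonneg ndiag_pos noff_nonneg zero_less_power
    add_nonneg_nonneg) auto

text \<open>In \<open>pdiag b a z x\<close> the variables are swapped, so its derivative in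
  \<open>z\<close> is \<open>pdiag_dx b a z x u\<close> and its derivative in \<open>x\<close> is
  \<open>pdiag_dz b a z x u\<close>; the expression is thus the Jacobian determinant of the two
  diagonal entries.\<close>

lemma jacobian_pos:
  assumes "0 < a" "0 < b" "0 < d" "0 < x" "0 < z" "d \<le> x * z"
  defines "u \<equiv> x * z - d"
  shows "0 < pdiag_dx a b x z u * pdiag_dx b a z x u - pdiag_dz a b x z u * pdiag_dz b a z x u"
proof -
  \<comment> \<open>The quotient of the Jacobian by \<open>poff\<close>, with every product \<open>x * z\<close> rewritten as \<open>u + d\<close>.\<close>
  define j where "j =
    6*a^5*x^5 + 12*a^5*x^3*u + 6*a^5*x*u^2 + 12*a^4*b*x^3*u + 6*a^4*b*x^3*d + 24*a^4*b*x*u^2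
    + 28*a^4*b*x*u*d + 6*a^4*b*x*d^2 + 12*a^4*b*z*u^2 + 10*a^4*b*z*u*d + 6*a^3*b^2*x*u^2
    + 2*a^3*b^2*x*u*d + 6*a^3*b^2*z^3*u + 12*a^3*b^2*z*u^2 + 8*a^3*b^2*z*u*d + 6*a^2*b^3*x^3*u
    + 12*a^2*b^3*x*u^2 + 8*a^2*b^3*x*u*d + 6*a^2*b^3*z*u^2 + 2*a^2*b^3*z*u*d + 12*a*b^4*x*u^2
    + 10*a*b^4*x*u*d + 12*a*b^4*z^3*u + 6*a*b^4*z^3*d + 24*a*b^4*z*u^2 + 28*a*b^4*z*u*d
    + 6*a*b^4*z*d^2 + 6*b^5*z^5 + 12*b^5*z^3*u + 6*b^5*z*u^2"
  have u: "0 \<le> u" using assms by simp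
  then have "0 < j"
    unfolding j_def using assms(1-5) by (intro add_pos_nonneg) simp_all
  moreover have "pdiag_dx a b x z u * pdiag_dx b a z x u - pdiag_dz a b x z u * pdiag_dz b a z x u = poff a b x z u * j"
    unfolding j_def u_def pdiag_dx_def pdiag_dz_def poff_def ndiag_def noff_def by algebra
  ultimately show ?thesis
    using assms u by (simp add: poff_pos)
qed

section \<open>Monotonicity, derivative and bounds of a diagonal entry\<close>

text \<open>With \<open>x\<close> and \<open>d\<close> fixed, raising \<open>z\<close> also raises
  \<open>u = x * z - d\<close>, so no monomial decreases; strictness comes from the summand
  \<open>a * x * (x^2 + u)\<close> of \<open>ndiag\<close>.\<close>

lemma pdiag_strict_mono:
  assumes "0 < a" "0 < b" "0 < d" "0 < x" "d \<le> x * z" "z < z'"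
  shows "pdiag a b x z (x * z - d) < pdiag a b x z' (x * z' - d)"
proof -
  have z: "0 < z" using assms by (smt (verit) zero_less_mult_pos)
  have "x * z < x * z'" using assms by simp
  then have u: "0 \<le> x * z - d" "x * z - d < x * z' - d" "d \<le> x * z'" using assms by linarith+
  have "ndiag a b x z (x * z - d) < ndiag a b x z' (x * z' - d)"
    unfolding ndiag_def
  proof (rule add_less_le_mono)
    show "a * x * (x^2 + (x * z - d)) < a * x * (x^2 + (x * z' - d))"
      using assms by simp
    show "b * (x * z - d) * (x + z) \<le> b * (x * z' - d) * (x + z')"
      using assms z u by (intro mult_mono mult_nonneg_nonneg) auto
  qed
  moreover have "noff a b x z (x * z - d) \<le> noff a b x z' (x * z' - d)"
    unfolding noff_def using assms z u
    by (intro add_mono mult_left_mono power_mono) auto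
  ultimately show ?thesis
    unfolding pdiag_def using assms z u ndiag_pos[of a b x z "x * z - d"] noff_pos[of a b x z "x * z - d"]
    by (intro add_less_le_mono mult_strict_left_mono mult_mono power_strict_mono power_mono
      zero_less_power mult_nonneg_nonneg) auto
qed

text \<open>Here \<open>u = 0\<close> means that X is diagonal. The value does not depend on
  \<open>z\<close>, which locates the endpoint of each level curve.\<close>

lemma pdiag_boundary: "pdiag a b x z 0 = a^5 * x^6"
  by (simp add: pdiag_def ndiag_def power_mult_distrib flip: power_mult power_add) algebra

text \<open>\<open>X\<close> and \<open>Z\<close> are arbitrary functions so that the same chain
  rule serves both the coordinates of the plane and a parametrised curve.\<close>

lemma pdiag_has_derivative:
  assumes "(X has_derivative X') (at t within S)" and "(Z has_derivative Z') (at t within S)"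
  shows "((\<lambda>t. pdiag a b (X t) (Z t) (X t * Z t - d)) has_derivative
    (\<lambda>h. pdiag_dx a b (X t) (Z t) (X t * Z t - d) * X' h + pdiag_dz a b (X t) (Z t) (X t * Z t - d) * Z' h))
    (at t within S)"
proof -
  define N1 N2 where "N1 t = ndiag a b (X t) (Z t) (X t * Z t - d)"
    and "N2 t = noff a b (X t) (Z t) (X t * Z t - d)" for t
  let ?x = "X t" and ?z = "Z t" and ?u = "X t * Z t - d"
  have N1: "(N1 has_derivative (\<lambda>h.
      (a * (?x^2 + ?u) + a * ?x * (2 * ?x + ?z) + b * ?z * (?x + ?z) + b * ?u) * X' h
      + (a * ?x^2 + b * ?x * (?x + ?z) + b * ?u) * Z' h)) (at t within S)"
    unfolding N1_def ndiag_def
    by (rule derivative_eq_intros assms refl | simp add: fun_eq_iff algebra_simps power2_eq_square)+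
  have N2: "(N2 has_derivative (\<lambda>h.
      (a * (2 * ?x + ?z) + b * ?z) * X' h + (a * ?x + b * (?x + 2 * ?z)) * Z' h)) (at t within S)"
    unfolding N2_def noff_def
    by (rule derivative_eq_intros assms refl | simp add: fun_eq_iff algebra_simps power2_eq_square)+
  show ?thesis
    unfolding pdiag_def N1_def[symmetric] N2_def[symmetric]
    by (rule derivative_eq_intros assms refl N1 N2)+
      (simp add: pdiag_dx_def pdiag_dz_def fun_eq_iff algebra_simps power2_eq_square flip: N1_def N2_def)
qed

text \<open>Dropping all terms with \<open>b\<close> leaves a bound that is easy to make large; it
  supplies the upper values for both uses of the intermediate value theorem.\<close>

lemma pdiag_ge: "0 < a \<Longrightarrow> 0 < b \<Longrightarrow> 0 \<le> x \<Longrightarrow> 0 \<le> z \<Longrightarrow> 0 \<le> u \<Longrightarrow>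
    a^5 * (x * (x^2 + u))^2 \<le> pdiag a b x z u"
proof -
  assume *: "0 < a" "0 < b" "0 \<le> x" "0 \<le> z" "0 \<le> u"
  then have "(a * x * (x^2 + u))^2 \<le> (ndiag a b x z u)^2"
    unfolding ndiag_def by (intro power_mono) auto
  then have "a^3 * (a * x * (x^2 + u))^2 \<le> pdiag a b x z u"
    unfolding pdiag_def using * by (intro add_increasing2 mult_left_mono) auto
  moreover have "a^3 * (a * x * (x^2 + u))^2 = a^5 * (x * (x^2 + u))^2" by algebra
  ultimately show ?thesis by simp
qed

section \<open>The level curve of the first diagonal entry\<close>

text \<open>For fixed \<open>x\<close> the entry increases strictly in \<open>z\<close>, starting
  from \<open>a^5 * x^6\<close> at \<open>z = d / x\<close>, and is unbounded. So it takes the value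
  \<open>a^5 * r^6\<close> exactly when \<open>x \<le> r\<close>, and then only once.\<close>

lemma level_curve:
  assumes "0 < a" "0 < b" "0 < d" "0 < r"
  obtains \<zeta> where "continuous_on {0<..r} \<zeta>"
    and "\<And>x. x \<in> {0<..r} \<Longrightarrow> d \<le> x * \<zeta> x"
    and "\<And>x z. 0 < x \<Longrightarrow> d \<le> x * z \<Longrightarrow>
      pdiag a b x z (x * z - d) = a^5 * r^6 \<longleftrightarrow> x \<le> r \<and> z = \<zeta> x"
proof -
  define f where "f x z = pdiag a b x z (x * z - d)" for x z
  define A where "A = a^5 * r^6"
  have f_less: "f x z < f x z'" if "0 < x" "d \<le> x * z" "z < z'" for x z z'
    using pdiag_strict_mono[of a b d x z z'] assms that by (simp add: f_def)
  have f_0: "f x (d / x) = a^5 * x^6" if "0 < x" for x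
    using that pdiag_boundary[of a b x "d / x"] by (simp add: f_def)
  have cont: "continuous_on S (\<lambda>z. f x z)" "continuous_on S (\<lambda>x. f x z)" for S x z
    unfolding f_def pdiag_def ndiag_def noff_def by (intro continuous_intros)+
  have ex: "\<exists>z. d \<le> x * z \<and> f x z = A" if x: "x \<in> {0<..r}" for x
  proof -
    \<comment> \<open>Chosen so that \<open>u = x * v - d\<close> satisfies x u = r^3; then
      \<open>pdiag_ge\<close> already gives at least \<open>a^5 * r^6\<close>.\<close>
    define v where "v = (d + r^3 / x) / x"
    have v: "x * v - d = r^3 / x" "d / x \<le> v" "0 \<le> v"
      using assms x by (auto simp: v_def divide_right_mono)
    have "a^5 * (x * (r^3 / x))^2 \<le> a^5 * (x * (x^2 + r^3 / x))^2"
      using assms x by (intro mult_left_mono power_mono) auto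
    also have "\<dots> \<le> f x v"
      using pdiag_ge[of a b x v "r^3 / x"] assms x v by (simp add: f_def)
    finally have "A \<le> f x v"
      using x by (simp add: A_def flip: power_mult)
    moreover have "f x (d / x) \<le> A"
      using f_0[of x] assms x by (auto simp: A_def intro!: mult_left_mono power_mono)
    ultimately obtain z where "d / x \<le> z" "f x z = A"
      using IVT'[of "f x" "d / x" A v] cont v by blast
    then show ?thesis
      using x by (auto simp: pos_divide_le_eq mult.commute)
  qed
  then obtain \<zeta> where \<zeta>: "\<And>x. x \<in> {0<..r} \<Longrightarrow> d \<le> x * \<zeta> x" "\<And>x. x \<in> {0<..r} \<Longrightarrow> f x (\<zeta> x) = A"
    by metis
  have iff: "f x z = A \<longleftrightarrow> x \<le> r \<and> z = \<zeta> x" if "0 < x" "d \<le> x * z" for x z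
  proof
    assume z: "f x z = A"
    have "a^5 * x^6 \<le> A"
      using f_0 f_less[of x "d / x" z] z that
      by (cases "z = d / x") (auto simp: field_simps less_eq_real_def)
    then have "x \<le> r"
      using assms that by (simp add: A_def power_mono_iff)
    then show "x \<le> r \<and> z = \<zeta> x"
      using z that \<zeta>[of x] f_less[of x z "\<zeta> x"] f_less[of x "\<zeta> x" z] by force
  qed (use that \<zeta> in auto)
  \<comment> \<open>By strict monotonicity in \<open>z\<close>, comparing \<open>c\<close> with
    \<open>\<zeta> x\<close> amounts to comparing \<open>f x c\<close> with \<open>A\<close>, and
    strict inequalities of the latter kind persist nearby because \<open>f\<close> is continuous in
    \<open>x\<close>.\<close>
  have cont_\<zeta>: "continuous_on {0<..r} \<zeta>"
    unfolding continuous_on_def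
  proof (intro ballI order_tendstoI)
    fix x c assume x: "x \<in> {0<..r}" and c: "c < \<zeta> x"
    \<comment> \<open>Monotonicity is available only where \<open>d \<le> t * c\<close>; a
      \<open>c\<close> below that range is below \<open>\<zeta> t\<close> anyway.\<close>
    have "\<forall>\<^sub>F t in at x within {0<..r}. t * c < d \<or> f t c < A"
    proof (cases "x * c < d")
      case True
      have "((\<lambda>t. t * c) \<longlongrightarrow> x * c) (at x within {0<..r})"
        by (intro tendsto_intros)
      from order_tendstoD(2)[OF this True] show ?thesis
        by (rule eventually_mono) simp
    next
      case False
      then have "f x c < A"
        using f_less[of x c "\<zeta> x"] \<zeta>(2)[of x] x c by simp
      moreover have "((\<lambda>t. f t c) \<longlongrightarrow> f x c) (at x within {0<..r})"
        using cont(2)[of "{0<..r}" c] x by (simp add: continuous_on_def)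
      ultimately show ?thesis
        by (metis (mono_tags, lifting) eventually_mono order_tendstoD(2))
    qed
    then show "\<forall>\<^sub>F t in at x within {0<..r}. c < \<zeta> t"
    proof (rule eventually_mp[rotated],
        intro eventually_at_topological[THEN iffD2] exI[of _ UNIV] conjI ballI impI)
      fix t assume t: "t \<in> {0<..r}" and "t * c < d \<or> f t c < A"
      show "c < \<zeta> t"
      proof (rule ccontr)
        assume "\<not> c < \<zeta> t"
        then have "\<zeta> t \<le> c" by simp
        then have "t * \<zeta> t \<le> t * c" using t by simp
        then have "d \<le> t * c" using \<zeta>(1)[OF t] by linarith
        moreover have "A \<le> f t c"
          using f_less[of t "\<zeta> t" c] \<zeta>[OF t] t \<open>\<zeta> t \<le> c\<close> by (cases "\<zeta> t = c") auto
        ultimately show False using \<open>t * c < d \<or> f t c < A\<close> by simp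
      qed
    qed auto
  next
    fix x c assume x: "x \<in> {0<..r}" and c: "\<zeta> x < c"
    have "A < f x c"
      using f_less[of x "\<zeta> x" c] \<zeta>[of x] x c by simp
    moreover have "((\<lambda>t. f t c) \<longlongrightarrow> f x c) (at x within {0<..r})"
      using cont(2)[of "{0<..r}" c] x by (simp add: continuous_on_def)
    ultimately have 1: "\<forall>\<^sub>F t in at x within {0<..r}. A < f t c"
      by (metis order_tendstoD(1))
    have "x * \<zeta> x < x * c" using x c by simp
    then have "d < x * c" using \<zeta>(1)[OF x] by linarith
    moreover have "((\<lambda>t. t * c) \<longlongrightarrow> x * c) (at x within {0<..r})"
      by (intro tendsto_intros)
    ultimately have 2: "\<forall>\<^sub>F t in at x within {0<..r}. d < t * c"
      by (metis order_tendstoD(1))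
    have 3: "\<forall>\<^sub>F t in at x within {0<..r}. t \<in> {0<..r}"
      by (simp add: eventually_at_filter)
    from 1 2 3 show "\<forall>\<^sub>F t in at x within {0<..r}. \<zeta> t < c"
    proof eventually_elim
      case (elim t)
      then show ?case
        using f_less[of t c "\<zeta> t"] \<zeta>(2)[of t] by (cases "\<zeta> t" c rule: linorder_cases) auto
    qed
  qed
  show thesis
    by (rule that[OF cont_\<zeta> \<zeta>(1) iff[unfolded f_def A_def]])
qed

text \<open>Substituting the slope of \<open>\<zeta>\<close> into the chain rule gives minus the
  Jacobian divided by \<open>pdiag_dz\<close>. The curve may end at \<open>r\<close>, so derivatives
  are taken only at interior points and continuity covers the ends.\<close>

lemma pdiag_decreasing_on_level_curve:
  assumes "0 < a" "0 < b" "0 < d" and cont: "continuous_on {0<..r} \<zeta>"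
    and \<zeta>: "\<And>x. x \<in> {0<..r} \<Longrightarrow> d \<le> x * \<zeta> x"
    and level: "\<And>x. x \<in> {0<..r} \<Longrightarrow> pdiag a b x (\<zeta> x) (x * \<zeta> x - d) = A"
    and "0 < s" "s < t" "t \<le> r"
  shows "pdiag b a (\<zeta> t) t (t * \<zeta> t - d) < pdiag b a (\<zeta> s) s (s * \<zeta> s - d)"
proof (rule DERIV_neg_imp_decreasing_open[OF \<open>s < t\<close>])
  fix x assume x: "s < x" "x < t"
  then have x0: "0 < x" and xr: "x \<in> {0<..<r}"
    using assms by auto
  have "0 < x * \<zeta> x"
    using \<zeta>[of x] xr \<open>0 < d\<close> by simp
  then have z0: "0 < \<zeta> x"
    using x0 by (simp add: zero_less_mult_iff)
  define u where "u = x * \<zeta> x - d"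
  define q where "q = pdiag_dz a b x (\<zeta> x) u"
  have q: "0 < q"
    unfolding q_def using assms x0 z0 \<zeta>[of x] xr by (intro pdiag_dz_pos) (auto simp: u_def)
  have F: "((\<lambda>p. pdiag a b (fst p) (snd p) (fst p * snd p - d)) has_derivative
      (\<lambda>(h, k). pdiag_dx a b x (\<zeta> x) u * h + q * k)) (at (x, \<zeta> x))"
    using pdiag_has_derivative[OF has_derivative_fst[OF has_derivative_ident]
        has_derivative_snd[OF has_derivative_ident],
        where t = "(x, \<zeta> x)" and S = UNIV and a = a and b = b and d = d]
    by (simp add: u_def q_def case_prod_unfold)
  have "continuous_on {0<..<r} \<zeta>"
    using cont by (rule continuous_on_subset) auto
  then have "isCont \<zeta> x"
    using xr by (simp add: continuous_on_eq_continuous_at)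
  moreover have "\<forall>\<^sub>F t in nhds x. t \<in> {0<..<r}"
    using xr by (intro eventually_nhds_in_open) auto
  then have "\<forall>\<^sub>F t in nhds x. pdiag a b t (\<zeta> t) (t * \<zeta> t - d) = pdiag a b x (\<zeta> x) (x * \<zeta> x - d)"
    by (rule eventually_mono) (use level xr in auto)
  moreover define v where "v = - pdiag_dx a b x (\<zeta> x) u / q"
  ultimately have "(\<zeta> has_derivative (*) v) (at x)"
    using implicit_curve_derivative[where \<zeta> = \<zeta> and x = x, OF F] q
    by (simp add: has_field_derivative_def)
  from pdiag_has_derivative[OF this has_derivative_ident, of b a d]
  have "((\<lambda>t. pdiag b a (\<zeta> t) t (t * \<zeta> t - d)) has_derivative
      (\<lambda>h. pdiag_dx b a (\<zeta> x) x u * (v * h) + pdiag_dz b a (\<zeta> x) x u * h)) (at x)"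
    by (simp add: u_def mult.commute[of "\<zeta> _"])
  then have "((\<lambda>t. pdiag b a (\<zeta> t) t (t * \<zeta> t - d)) has_real_derivative
      pdiag_dx b a (\<zeta> x) x u * v + pdiag_dz b a (\<zeta> x) x u) (at x)"
    unfolding has_field_derivative_def
    by (rule has_derivative_eq_rhs) (simp add: fun_eq_iff algebra_simps)
  moreover have "pdiag_dx b a (\<zeta> x) x u * v + pdiag_dz b a (\<zeta> x) x u
      = - (pdiag_dx a b x (\<zeta> x) u * pdiag_dx b a (\<zeta> x) x u - q * pdiag_dz b a (\<zeta> x) x u) / q"
    using q by (simp add: v_def field_simps)
  moreover have "\<dots> < 0"
    using jacobian_pos[of a b d x "\<zeta> x"] assms x0 z0 \<zeta>[of x] xr q
    by (simp add: u_def q_def divide_less_0_iff)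
  ultimately show "\<exists>y. ((\<lambda>t. pdiag b a (\<zeta> t) t (t * \<zeta> t - d)) has_real_derivative y) (at x) \<and> y < 0"
    by metis
next
  have "continuous_on {s..t} \<zeta>"
    using cont by (rule continuous_on_subset) (use assms in auto)
  then show "continuous_on {s..t} (\<lambda>t. pdiag b a (\<zeta> t) t (t * \<zeta> t - d))"
    unfolding pdiag_def ndiag_def noff_def by (intro continuous_intros)
qed

section \<open>Solving the scalar equations\<close>

text \<open>Along the level curve for \<open>A\<close>, the second entry is a strictly decreasing
  function \<open>h\<close> of \<open>x\<close>, which gives uniqueness. At \<open>x = r\<close> the
  off-diagonal entry vanishes, so the determinant identity turns \<open>AC\<close> into
  \<open>h r \<le> C\<close>; existence then needs a point where \<open>h\<close> is at least
  \<open>C\<close>.\<close>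

lemma diagonal_entries_ex1:
  assumes "0 < a" "0 < b" "0 < d" "0 < A" "0 < C" and AC: "(a * b)^5 * d^6 \<le> A * C"
  shows "\<exists>!(x, z). 0 < x \<and> 0 < z \<and> d \<le> x * z \<and>
    pdiag a b x z (x * z - d) = A \<and> pdiag b a z x (x * z - d) = C"
proof -
  define r where "r = root 6 (A / a^5)"
  have r: "0 < r" "a^5 * r^6 = A"
    using assms by (simp_all add: r_def)
  define w where "w = root 6 (C / b^5)"
  have w: "0 < w" "b^5 * w^6 = C"
    using assms by (simp_all add: w_def)
  obtain \<zeta> where cont: "continuous_on {0<..r} \<zeta>"
    and \<zeta>: "\<And>x. x \<in> {0<..r} \<Longrightarrow> d \<le> x * \<zeta> x"
    and iff: "\<And>x z. 0 < x \<Longrightarrow> d \<le> x * z \<Longrightarrow> pdiag a b x z (x * z - d) = A \<longleftrightarrow> x \<le> r \<and> z = \<zeta> x"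
    by (rule level_curve[OF assms(1-3) r(1), unfolded r(2)]) (rule that)
  define h where "h x = pdiag b a (\<zeta> x) x (x * \<zeta> x - d)" for x
  have level: "pdiag a b x (\<zeta> x) (x * \<zeta> x - d) = A" if "x \<in> {0<..r}" for x
    using iff[of x "\<zeta> x"] \<zeta>[of x] that by simp
  have h_less: "h t < h s" if "0 < s" "s < t" "t \<le> r" for s t
    unfolding h_def by (rule pdiag_decreasing_on_level_curve[OF assms(1-3) cont \<zeta> level that])
  have pos: "0 < \<zeta> x" if "x \<in> {0<..r}" for x
    using \<zeta>[OF that] that \<open>0 < d\<close> by (smt (verit) greaterThanAtMost_iff zero_less_mult_pos)
  have \<zeta>_r: "\<zeta> r = d / r"
    using iff[of r "d / r"] pdiag_boundary[of a b r "d / r"] r by simp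
  have "(a * b)^5 * d^6 \<le> (a * b)^5 * (r * w)^6"
    using AC unfolding r(2)[symmetric] w(2)[symmetric] by (simp add: power_mult_distrib mult_ac)
  then have "d \<le> r * w"
    using assms r w by (simp add: power_mono_iff)
  \<comment> \<open>At this point \<open>d \<le> s * \<zeta> s\<close> forces
    \<open>w \<le> \<zeta> s\<close>, and \<open>w\<close> was chosen so that
    \<open>b^5 * w^6 = C\<close>; hence \<open>h s\<close> is at least \<open>C\<close>.\<close>
  define s where "s = d / w"
  have s: "0 < s" "s \<le> r"
    using assms w \<open>d \<le> r * w\<close> by (auto simp: s_def pos_divide_le_eq)
  have "w \<le> \<zeta> s"
    using \<zeta>[of s] s w \<open>0 < d\<close> by (simp add: s_def field_simps)
  have "C \<le> b^5 * (\<zeta> s)^6"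
    unfolding w(2)[symmetric] using \<open>0 < b\<close> w(1) \<open>w \<le> \<zeta> s\<close> by (simp add: power_mono)
  also have "\<dots> = b^5 * (\<zeta> s * ((\<zeta> s)^2 + 0))^2" by algebra
  also have "\<dots> \<le> b^5 * (\<zeta> s * ((\<zeta> s)^2 + (s * \<zeta> s - d)))^2"
    using assms pos[of s] \<zeta>[of s] s by (intro mult_left_mono power_mono) auto
  also have "\<dots> \<le> h s"
    unfolding h_def using assms pos[of s] \<zeta>[of s] s by (intro pdiag_ge) auto
  finally have "C \<le> h s" .
  moreover have "h r \<le> C"
  proof -
    have "A * h r = (a * b)^5 * d^6"
      using pdiag_poff_det[of a b r "\<zeta> r" "r * \<zeta> r - d"] level[of r] r by (simp add: h_def \<zeta>_r)
    then show ?thesis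
      using AC \<open>0 < A\<close> by (metis mult_le_cancel_left_pos)
  qed
  moreover have "continuous_on {s..r} h"
  proof -
    have "continuous_on {s..r} \<zeta>"
      using cont by (rule continuous_on_subset) (use s in auto)
    then show ?thesis
      unfolding h_def pdiag_def ndiag_def noff_def by (intro continuous_intros)
  qed
  ultimately obtain x where x: "s \<le> x" "x \<le> r" "h x = C"
    using IVT2'[of h r C s] s by blast
  show ?thesis
  proof (rule ex1I[of _ "(x, \<zeta> x)"])
    show "case (x, \<zeta> x) of (x, z) \<Rightarrow> 0 < x \<and> 0 < z \<and> d \<le> x * z \<and>
        pdiag a b x z (x * z - d) = A \<and> pdiag b a z x (x * z - d) = C"
      using x s pos \<zeta> level by (simp add: h_def)
    fix y assume "case y of (x, z) \<Rightarrow> 0 < x \<and> 0 < z \<and> d \<le> x * z \<and>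
        pdiag a b x z (x * z - d) = A \<and> pdiag b a z x (x * z - d) = C"
    then obtain x' where x': "y = (x', \<zeta> x')" "0 < x'" "x' \<le> r" "h x' = C"
      using iff by (cases y) (auto simp: h_def)
    then show "y = (x, \<zeta> x)"
      using h_less[of x x'] h_less[of x' x] x s by (cases x x' rule: linorder_cases) auto
  qed
qed

lemma entries_ex1:
  assumes "0 < a" "0 < b" "0 < A" "0 < C" "E^2 < A * C"
  shows "\<exists>!(x, y, z). 0 \<le> x \<and> 0 \<le> z \<and> y^2 \<le> x * z \<and>
    pdiag a b x z (y^2) = A \<and> y * poff a b x z (y^2) = E \<and> pdiag b a z x (y^2) = C"
proof -
  define d where "d = root 6 ((A * C - E^2) / (a * b)^5)"
  have d: "0 < d" "(a * b)^5 * d^6 = A * C - E^2"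
    using assms by (simp_all add: d_def)
  define sol where "sol x z \<longleftrightarrow> 0 < x \<and> 0 < z \<and> d \<le> x * z \<and>
    pdiag a b x z (x * z - d) = A \<and> pdiag b a z x (x * z - d) = C" for x z
  have "\<exists>!(x, z). sol x z"
    unfolding sol_def using assms d by (intro diagonal_entries_ex1) auto
  then obtain x0 z0 where sol: "sol x0 z0" and uniq: "\<And>x z. sol x z \<Longrightarrow> x = x0 \<and> z = z0"
    by fastforce
  define u where "u = x0 * z0 - d"
  define y0 where "y0 = E / poff a b x0 z0 u"
  have "0 \<le> u" and poff: "0 < poff a b x0 z0 u"
    using sol assms by (auto simp: sol_def u_def intro!: poff_pos)
  \<comment> \<open>The choice of \<open>d\<close> makes the determinant identity yield this, so the
    \<open>y0\<close> that solves the off-diagonal equation automatically has square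
    \<open>u\<close>.\<close>
  have "E^2 = u * (poff a b x0 z0 u)^2"
    using pdiag_poff_det[of a b x0 z0 u] sol d by (simp add: sol_def u_def)
  then have y0: "y0^2 = u"
    using poff by (simp add: y0_def power_divide)
  show ?thesis
  proof (rule ex1I[of _ "(x0, y0, z0)"])
    show "case (x0, y0, z0) of (x, y, z) \<Rightarrow> 0 \<le> x \<and> 0 \<le> z \<and> y^2 \<le> x * z \<and>
        pdiag a b x z (y^2) = A \<and> y * poff a b x z (y^2) = E \<and> pdiag b a z x (y^2) = C"
      using sol y0 poff d by (simp add: sol_def u_def y0_def)
    fix t assume "case t of (x, y, z) \<Rightarrow> 0 \<le> x \<and> 0 \<le> z \<and> y^2 \<le> x * z \<and>
        pdiag a b x z (y^2) = A \<and> y * poff a b x z (y^2) = E \<and> pdiag b a z x (y^2) = C"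
    then obtain x y z where t: "t = (x, y, z)" "0 \<le> x" "0 \<le> z" "y^2 \<le> x * z"
      and eqs: "pdiag a b x z (y^2) = A" "y * poff a b x z (y^2) = E" "pdiag b a z x (y^2) = C"
      by (cases t) auto
    have "(a * b)^5 * (x * z - y^2)^6 = A * C - E^2"
      using pdiag_poff_det[of a b x z "y^2"] eqs by (simp add: power_mult_distrib[symmetric])
    then have "(x * z - y^2)^6 = d^6"
      using d assms by (metis mult_left_cancel mult_pos_pos order_less_irrefl zero_less_power)
    \<comment> \<open>Semidefiniteness makes \<open>x * z - y^2\<close> nonnegative, so its sixth
      power determines it.\<close>
    then have det: "x * z - y^2 = d"
      using t d by (intro power_eq_imp_eq_base[of _ 6 d]) auto
    then have "0 < x * z"
      using d zero_le_power2[of y] by linarith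
    then have "0 < x" "0 < z"
      using t by (auto simp: zero_less_mult_iff)
    moreover have "x * z - d = y^2" using det by simp
    ultimately have "sol x z"
      using eqs det zero_le_power2[of y] unfolding sol_def by (auto simp del: zero_le_power2)
    then have "x = x0" "z = z0" using uniq by auto
    moreover have "y^2 = u" using \<open>x * z - d = y^2\<close> calculation by (simp add: u_def)
    ultimately show "t = (x0, y0, z0)"
      using t eqs poff by (auto simp: y0_def)
  qed
qed

section \<open>Symmetric 2x2 matrices: eigenvalues, positivity, diagonalization\<close>

definition mat2 :: "real \<Rightarrow> real \<Rightarrow> real \<Rightarrow> real \<Rightarrow> real^2^2" where
  "mat2 p q r s = vector [vector [p, q], vector [r, s]]"

lemma mat2_nth [simp]:
  "mat2 p q r s $ 1 $ 1 = p" "mat2 p q r s $ 1 $ 2 = q"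
  "mat2 p q r s $ 2 $ 1 = r" "mat2 p q r s $ 2 $ 2 = s"
  by (simp_all add: mat2_def)

lemma mat2_eq_iff [simp]:
  "mat2 p q r s = mat2 p' q' r' s' \<longleftrightarrow> p = p' \<and> q = q' \<and> r = r' \<and> s = s'"
  by (auto simp: vec_eq_iff forall_2)

lemma mat2_mult [simp]:
  "mat2 p q r s ** mat2 p' q' r' s' =
    mat2 (p * p' + q * r') (p * q' + q * s') (r * p' + s * r') (r * q' + s * s')"
  by (simp add: vec_eq_iff forall_2 matrix_matrix_mult_def sum_2)

lemma transpose_mat2 [simp]: "transpose (mat2 p q r s) = mat2 p r q s"
  by (simp add: vec_eq_iff forall_2 transpose_def)

lemma mat_1_eq_mat2: "mat 1 = mat2 1 0 0 1"
  by (simp add: vec_eq_iff forall_2 mat_def)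

lemma symmetric_mat2E:
  assumes "transpose A = A"
  obtains x y z where "A = mat2 x y y z"
proof
  have "A $ 2 $ 1 = A $ 1 $ 2"
    using arg_cong[OF assms, of "\<lambda>M. M $ 1 $ 2"] by (simp add: transpose_def)
  then show "A = mat2 (A $ 1 $ 1) (A $ 1 $ 2) (A $ 1 $ 2) (A $ 2 $ 2)"
    by (simp add: vec_eq_iff forall_2)
qed

lemma eigenvalue_mat2: "eigenvalue (mat2 x y y z) c \<longleftrightarrow> (x - c) * (z - c) = y^2"
proof
  assume "eigenvalue (mat2 x y y z) c"
  then obtain v :: "real^2" where "v \<noteq> 0" and "mat2 x y y z *v v = c *s v"
    by (auto simp: eigenvalue_def)
  then have v: "x * v$1 + y * v$2 = c * v$1" "y * v$1 + z * v$2 = c * v$2"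
    by (auto simp: vec_eq_iff forall_2 matrix_vector_mult_def sum_2)
  then have "((x - c) * (z - c) - y^2) * v$1 = 0" "((x - c) * (z - c) - y^2) * v$2 = 0"
    by algebra+
  with \<open>v \<noteq> 0\<close> show "(x - c) * (z - c) = y^2"
    by (auto simp: vec_eq_iff forall_2)
next
  assume c: "(x - c) * (z - c) = y^2"
  consider "y = 0" "x = c" | "y = 0" "z = c" | "y \<noteq> 0"
    using c by (cases "y = 0") auto
  then have "\<exists>v1 v2. (v1 \<noteq> 0 \<or> v2 \<noteq> 0) \<and> x * v1 + y * v2 = c * v1 \<and> y * v1 + z * v2 = c * v2"
  proof cases
    case 3
    \<comment> \<open>The vector (y, c - x) is orthogonal to the first row of the matrix minus c I;
      the characteristic equation gives the second row.\<close>
    then show ?thesis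
      using c by (intro exI[of _ y] exI[of _ "c - x"]) (simp add: algebra_simps power2_eq_square)
  next
    case 1
    then show ?thesis by (intro exI[of _ 1] exI[of _ 0]) simp
  next
    case 2
    then show ?thesis by (intro exI[of _ 0] exI[of _ 1]) simp
  qed
  then obtain v1 v2 where "(v1 \<noteq> 0 \<or> v2 \<noteq> 0) \<and> x * v1 + y * v2 = c * v1 \<and> y * v1 + z * v2 = c * v2"
    by blast
  then show "eigenvalue (mat2 x y y z) c"
    unfolding eigenvalue_def
    by (intro exI[of _ "vector [v1, v2]"])
      (auto simp: vec_eq_iff forall_2 matrix_vector_mult_def sum_2)
qed

text \<open>\<open>m\<close> is the smaller root of the characteristic polynomial and
  \<open>x + z - m\<close> the other, so the last equation writes the determinant as the product of
  the eigenvalues.\<close>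

lemma least_eigenvalue_mat2:
  obtains m where "eigenvalue (mat2 x y y z) m" "m \<le> x" "m \<le> z"
    "x * z - y^2 = m * (x + z - m)"
proof -
  define s where "s = sqrt ((x - z)^2 + 4 * y^2)"
  define m where "m = (x + z - s) / 2"
  have "\<bar>x - z\<bar> \<le> s"
    unfolding s_def by (rule real_le_rsqrt) simp
  then have "m \<le> x" "m \<le> z"
    by (auto simp: m_def)
  have "s^2 = (x - z)^2 + 4 * y^2"
    by (simp add: s_def)
  then have m: "(x - m) * (z - m) = y^2"
    unfolding m_def by (simp add: field_simps power2_eq_square)
  then show thesis
    using that[of m] \<open>m \<le> x\<close> \<open>m \<le> z\<close> by (simp add: eigenvalue_mat2 algebra_simps)
qed

lemma pos_semidef_mat2_iff: "pos_semidef (mat2 x y y z) \<longleftrightarrow> 0 \<le> x \<and> 0 \<le> z \<and> y^2 \<le> x * z"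
proof
  assume *: "pos_semidef (mat2 x y y z)"
  obtain m where m: "eigenvalue (mat2 x y y z) m" "m \<le> x" "m \<le> z" "x * z - y^2 = m * (x + z - m)"
    by (rule least_eigenvalue_mat2)
  with * have "0 \<le> m"
    by (simp add: pos_semidef_def)
  then have "0 \<le> m * (x + z - m)"
    using m by (intro mult_nonneg_nonneg) auto
  then show "0 \<le> x \<and> 0 \<le> z \<and> y^2 \<le> x * z"
    using m \<open>0 \<le> m\<close> by linarith
next
  assume *: "0 \<le> x \<and> 0 \<le> z \<and> y^2 \<le> x * z"
  have "0 \<le> c" if "(x - c) * (z - c) = y^2" for c
  \<comment> \<open>For negative \<open>c\<close>, (x - c)(z - c) = x z - c (x + z) + c^2 would
    exceed x z, hence y^2.\<close>
  proof (rule ccontr)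
    assume "\<not> 0 \<le> c"
    then have "0 < c * c" "c * (x + z) \<le> 0"
      using * by (auto simp: mult_neg_neg mult_nonpos_nonneg)
    then show False
      using * that by (simp add: algebra_simps)
  qed
  then show "pos_semidef (mat2 x y y z)"
    by (simp add: pos_semidef_def eigenvalue_mat2)
qed

lemma pos_def_mat2D:
  assumes "pos_def (mat2 x y y z)"
  shows "0 < x" "0 < z" "y^2 < x * z"
proof -
  obtain m where m: "eigenvalue (mat2 x y y z) m" "m \<le> x" "m \<le> z" "x * z - y^2 = m * (x + z - m)"
    by (rule least_eigenvalue_mat2)
  with assms have "0 < m"
    by (simp add: pos_def_def)
  then have "0 < m * (x + z - m)"
    using m by (intro mult_pos_pos) auto
  then show "0 < x" "0 < z" "y^2 < x * z"
    using m \<open>0 < m\<close> by linarith+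
qed

text \<open>Rotating by half the polar angle of ((x - z)/2, y) removes the off-diagonal entry; polar
  coordinates avoid a separate case \<open>x = z\<close>.\<close>

lemma symmetric_mat2_diagonalize:
  obtains U a b where "orthogonal_matrix U" "transpose U ** mat2 x y y z ** U = mat2 a 0 0 b"
proof -
  obtain r \<phi> where r: "(x - z) / 2 = r * cos \<phi>" "y = r * sin \<phi>"
    using polar_Ex by blast
  define c s where "c = cos (\<phi> / 2)" and "s = sin (\<phi> / 2)"
  have cs: "c^2 + s^2 = 1" "cos \<phi> = c^2 - s^2" "sin \<phi> = 2 * s * c"
    using cos_double[of "\<phi> / 2"] sin_double[of "\<phi> / 2"] by (simp_all add: c_def s_def)
  show thesis
  proof (rule that[of "mat2 c (- s) s c"])
    show "orthogonal_matrix (mat2 c (- s) s c)"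
      using cs(1) by (simp add: orthogonal_matrix mat_1_eq_mat2 power2_eq_square algebra_simps)
    have "(c * x + s * y) * - s + (c * y + s * z) * c = 0"
      "(- s * x + c * y) * c + (- s * y + c * z) * s = 0"
      using r cs by algebra+
    then show "transpose (mat2 c (- s) s c) ** mat2 x y y z ** mat2 c (- s) s c =
        mat2 ((c * x + s * y) * c + (c * y + s * z) * s) 0 0
          ((- s * x + c * y) * - s + (- s * y + c * z) * c)"
      by simp
  qed
qed

section \<open>The word equation for diagonal B\<close>

definition word :: "real^'n^'n \<Rightarrow> real^'n^'n \<Rightarrow> real^'n^'n" where
  "word X B = X ** B ** mat_power X 2 ** mat_power B 3 ** mat_power X 2 ** B ** X"

lemma word_mat2_diag:
  "word (mat2 x y y z) (mat2 a 0 0 b) =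
    mat2 (pdiag a b x z (y^2)) (y * poff a b x z (y^2)) (y * poff a b x z (y^2)) (pdiag b a z x (y^2))"
proof -
  define N where "N = mat2 (ndiag a b x z (y^2)) (y * noff a b x z (y^2))
    (y * noff b a z x (y^2)) (ndiag b a z x (y^2))"
  let ?X = "mat2 x y y z" and ?D = "mat2 a 0 0 b"
  have X2: "mat_power ?X 2 = mat2 (x^2 + y^2) (y * (x + z)) (y * (x + z)) (y^2 + z^2)"
    by (simp add: numeral_2_eq_2 mat_1_eq_mat2 algebra_simps power2_eq_square)
  have D3: "mat_power ?D 3 = mat2 (a^3) 0 0 (b^3)"
    by (simp add: numeral_3_eq_3 mat_1_eq_mat2)
  have "?X ** ?D ** mat_power ?X 2 = N"
    unfolding X2 N_def ndiag_def noff_def mat2_mult mat2_eq_iff by (intro conjI; algebra)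
  moreover have "mat_power ?X 2 ** ?D ** ?X = transpose N"
    unfolding X2 N_def ndiag_def noff_def mat2_mult mat2_eq_iff transpose_mat2 by (intro conjI; algebra)
  ultimately have "word ?X ?D = N ** mat2 (a^3) 0 0 (b^3) ** transpose N"
    unfolding word_def D3[symmetric] by (metis matrix_mul_assoc)
  also have "\<dots> = mat2 (pdiag a b x z (y^2)) (y * poff a b x z (y^2)) (y * poff a b x z (y^2)) (pdiag b a z x (y^2))"
    unfolding N_def pdiag_def poff_def mat2_mult mat2_eq_iff transpose_mat2 by (intro conjI; algebra)
  finally show ?thesis .
qed

lemma word_diag_ex1:
  assumes "pos_def (mat2 a 0 0 b)" and "pos_def P"
  shows "\<exists>!X. pos_semidef X \<and> word X (mat2 a 0 0 b) = P"
proof -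
  obtain A E C where P: "P = mat2 A E E C"
    using assms(2) by (auto simp: pos_def_def elim: symmetric_mat2E)
  have "0 < a" "0 < b" "0 < A" "0 < C" "E^2 < A * C"
    using pos_def_mat2D[OF assms(1)] pos_def_mat2D[OF assms(2)[unfolded P]] by auto
  from entries_ex1[OF this] obtain x y z where
    sol: "pos_semidef (mat2 x y y z) \<and> word (mat2 x y y z) (mat2 a 0 0 b) = P"
    and uniq: "\<And>x' y' z'. pos_semidef (mat2 x' y' y' z') \<and> word (mat2 x' y' y' z') (mat2 a 0 0 b) = P
      \<Longrightarrow> (x', y', z') = (x, y, z)"
    unfolding P word_mat2_diag pos_semidef_mat2_iff mat2_eq_iff by (auto simp: Ex1_def)
  show ?thesis
  proof (rule ex1I[of _ "mat2 x y y z"], rule sol)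
    fix X assume X: "pos_semidef X \<and> word X (mat2 a 0 0 b) = P"
    then obtain x' y' z' where "X = mat2 x' y' y' z'"
      by (auto simp: pos_semidef_def elim: symmetric_mat2E)
    then show "X = mat2 x y y z"
      using uniq X by auto
  qed
qed

section \<open>Invariance under orthogonal conjugation\<close>

context
  fixes U :: "real^'n^'n"
  assumes U: "orthogonal_matrix U"
begin

lemma conj_mult: "transpose U ** (A ** B) ** U = (transpose U ** A ** U) ** (transpose U ** B ** U)"
  using U by (metis matrix_mul_assoc matrix_mul_rid orthogonal_matrix_def)

lemma conj_cancel: "U ** (transpose U ** A ** U) ** transpose U = A"
  using U by (metis matrix_mul_assoc matrix_mul_lid matrix_mul_rid orthogonal_matrix_def)

lemma conj_mat_power: "transpose U ** mat_power A k ** U = mat_power (transpose U ** A ** U) k"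
proof (induction k)
  case 0
  then show ?case using U by (simp add: orthogonal_matrix)
next
  case (Suc k)
  then show ?case by (simp add: conj_mult)
qed

lemma conj_word: "transpose U ** word X B ** U = word (transpose U ** X ** U) (transpose U ** B ** U)"
  unfolding word_def by (simp only: conj_mult conj_mat_power)

text \<open>\<open>U\<close> maps eigenvectors to eigenvectors. Applied to
  \<open>transpose U ** A ** U\<close>, this shows that its eigenvalues are eigenvalues of
  \<open>A\<close>, the direction needed to transfer positivity.\<close>

lemma eigenvalue_conjI:
  assumes "eigenvalue A c"
  shows "eigenvalue (U ** A ** transpose U) c"
proof -
  obtain v where v: "v \<noteq> 0" "A *v v = c *s v"
    using assms by (auto simp: eigenvalue_def)
  have UU: "transpose U *v (U *v v) = v"
    using U by (simp add: matrix_vector_mul_assoc orthogonal_matrix_def)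
  have "(U ** A ** transpose U) *v (U *v v) = U *v (A *v (transpose U *v (U *v v)))"
    by (simp only: matrix_vector_mul_assoc matrix_mul_assoc)
  also have "\<dots> = c *s (U *v v)"
    by (simp only: UU v(2) vector_scalar_commute)
  finally show ?thesis
    unfolding eigenvalue_def using UU v(1) by (metis matrix_vector_mult_0_right)
qed

lemma symmetric_conj: "transpose A = A \<Longrightarrow> transpose (transpose U ** A ** U) = transpose U ** A ** U"
  by (simp add: matrix_transpose_mul matrix_mul_assoc)

lemma pos_def_conj: "pos_def A \<Longrightarrow> pos_def (transpose U ** A ** U)"
  unfolding pos_def_def using symmetric_conj[of A] eigenvalue_conjI conj_cancel[of A] by metis

lemma pos_semidef_conj: "pos_semidef A \<Longrightarrow> pos_semidef (transpose U ** A ** U)"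
  unfolding pos_semidef_def using symmetric_conj[of A] eigenvalue_conjI conj_cancel[of A] by metis

end

section \<open>Reduction to diagonal B\<close>

theorem theorem11p4:
  fixes B P :: "real^2^2"
  assumes "pos_def B" and "pos_def P"
  shows "\<exists>!X :: real^2^2. pos_semidef X \<and>
    X ** B ** mat_power X 2 ** mat_power B 3 ** mat_power X 2 ** B ** X = P"
proof -
  obtain x y z where "B = mat2 x y y z"
    using assms(1) by (auto simp: pos_def_def elim: symmetric_mat2E)
  then obtain U a b where U: "orthogonal_matrix U" and D: "transpose U ** B ** U = mat2 a 0 0 b"
    using symmetric_mat2_diagonalize by metis
  have U': "orthogonal_matrix (transpose U)"
    using U by simp
  \<comment> \<open>This is a bijection that preserves semidefiniteness in both directions and
    carries the equation for \<open>B\<close>, \<open>P\<close> to the one for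
    \<open>conj B\<close>, \<open>conj P\<close>, where \<open>conj B\<close> is diagonal; unique
    solvability is pulled back along it.\<close>
  define conj where "conj A = transpose U ** A ** U" for A
  have conj_inv: "U ** conj A ** transpose U = A" "conj (U ** A ** transpose U) = A" for A
    using conj_cancel[OF U] conj_cancel[OF U'] by (simp_all add: conj_def)
  have word_conj: "word (conj X) (conj B) = conj P \<longleftrightarrow> word X B = P" for X
    unfolding conj_def conj_word[OF U, symmetric] by (metis conj_cancel[OF U])
  have semidef: "pos_semidef (conj X) \<longleftrightarrow> pos_semidef X" for X
    using pos_semidef_conj[OF U, of X] pos_semidef_conj[OF U', of "conj X"] conj_inv(1)[of X]
    by (auto simp: conj_def)
  have "pos_def (conj B)" "pos_def (conj P)"
    unfolding conj_def using assms by (simp_all only: pos_def_conj[OF U])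
  then have "\<exists>!Y. pos_semidef Y \<and> word Y (conj B) = conj P"
    using word_diag_ex1[of a b "conj P"] by (simp only: conj_def D)
  then obtain Y where Y: "pos_semidef Y" "word Y (conj B) = conj P"
    and uniq: "\<And>Y'. pos_semidef Y' \<Longrightarrow> word Y' (conj B) = conj P \<Longrightarrow> Y' = Y"
    by blast
  show ?thesis
    unfolding word_def[symmetric]
  proof (rule ex1I[of _ "U ** Y ** transpose U"])
    show "pos_semidef (U ** Y ** transpose U) \<and> word (U ** Y ** transpose U) B = P"
      using Y semidef[of "U ** Y ** transpose U"] word_conj[of "U ** Y ** transpose U"]
      unfolding conj_inv by blast
    fix X assume "pos_semidef X \<and> word X B = P"
    then have "conj X = Y"
      by (intro uniq) (simp_all only: semidef word_conj)
    then show "X = U ** Y ** transpose U"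
      using conj_inv(1)[of X] by simp
  qed
qed

end
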